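(* Let $a,b>0$. Every collision sequence consisting of at least two collisions that is allowed as a capture process for mass ratios $(a,b)$ is, for some integer $n\ge1$, one of the following five: $(32)^n$, $(2)(32)^n$, $(21)^n$, $(21)^n(2)$, $(31)^n$.
   Context: Setting: three point particles 1, 2, 3 move in the plane, identified with $\mathbb{C}$, with masses $m_1,m_2,m_3>0$; put $a=m_1/m_2$, $b=m_3/m_2$. Between collisions particles move freely with constant velocity. A collision "$(i)$", $i\in\{1,2,3\}$, is a collision between the two particles other than $i$ (the spectator): the two particles are at the same position with nonzero relative velocity, and instantaneously their velocities change so that their total momentum is conserved and their relative velocity is multiplied by a complex number $x=e^{i\alpha}$, $|x|=1$ (so kinetic energy is conserved); the spectator's velocity is unchanged. The number $x$ (the scattering angle $\alpha$) may be any unit complex number and may be chosen independently at each collision. A collision sequence is written as a string in order of occurrence from left to right; e.g. $(32)^n$ is $(3)(2)\cdots(3)(2)$ with $2n$ collisions, and $(2)(32)^n$ is (2) followed by $(32)^n$. The times between successive collisions are required to be strictly positive, and no other interactions occur. Capture process: initially particles 2 and 3 are at rest at distinct points, and particle 1 has a nonzero velocity. A collision sequence is allowed as a capture process for $(a,b)$ if there exist initial positions and velocity of particle 1, initial positions of 2 and 3, and scattering angles such that the collisions of the sequence occur in that order, and after the last collision particles 1 and 2 have equal velocities. *)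

theory Defs
  imports Complex_Main
begin

datatype particle = P1 | P2 | P3

text \<open>
  A collision is named by its spectator \<open>i\<close>, so a collision sequence is a list of particles.
  Here \<open>q\<close> are the positions at the instant of the collision and \<open>v\<close>, \<open>v'\<close> the velocities
  just before and just after it.  The conditions are invariant under exchanging \<open>j\<close> and \<open>k\<close>.
\<close>

definition collision ::
  "(particle \<Rightarrow> real) \<Rightarrow> particle \<Rightarrow> complex \<Rightarrow>
   (particle \<Rightarrow> complex) \<Rightarrow> (particle \<Rightarrow> complex) \<Rightarrow> (particle \<Rightarrow> complex) \<Rightarrow> bool" where
  "collision m i x q v v' \<longleftrightarrow>
     v' i = v i \<and>
     (\<forall>j k. j \<noteq> i \<and> k \<noteq> i \<and> j \<noteq> k \<longrightarrow>
        q j = q k \<and> v j \<noteq> v k \<and>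
        of_real (m j) * v' j + of_real (m k) * v' k = of_real (m j) * v j + of_real (m k) * v k \<and>
        v' j - v' k = x * (v j - v k))"

text \<open>
  \<open>motion m q v w q' v'\<close>: from positions \<open>q\<close> and velocities \<open>v\<close> the system can undergo exactly the
  collisions \<open>w\<close>, in this order, and is in the state \<open>(q', v')\<close> just after the last one.
  Each collision is preceded by a free flight of positive duration \<open>t\<close>; for the first one this
  says that the initial state is taken before it.  Velocities change at the listed collisions only;
  an encounter that leaves all velocities unchanged is not an interaction, and is not forbidden.
\<close>

inductive motion ::
  "(particle \<Rightarrow> real) \<Rightarrow> (particle \<Rightarrow> complex) \<Rightarrow> (particle \<Rightarrow> complex) \<Rightarrow> particle list \<Rightarrow>
   (particle \<Rightarrow> complex) \<Rightarrow> (particle \<Rightarrow> complex) \<Rightarrow> bool"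
  for m :: "particle \<Rightarrow> real" where
  motion_Nil: "motion m q v [] q v"
| motion_Cons:
    "\<lbrakk> t > 0; cmod x = 1; q' = (\<lambda>j. q j + of_real t * v j);
       collision m i x q' v v'; motion m q' v' w q'' v'' \<rbrakk>
     \<Longrightarrow> motion m q v (i # w) q'' v''"

definition capture_process :: "(particle \<Rightarrow> real) \<Rightarrow> particle list \<Rightarrow> bool" where
  "capture_process m w \<longleftrightarrow>
     (\<exists>q v q' v'. v P1 \<noteq> 0 \<and> v P2 = 0 \<and> v P3 = 0 \<and> q P2 \<noteq> q P3 \<and>
        motion m q v w q' v' \<and> v' P1 = v' P2)"

definition allowed_capture :: "real \<Rightarrow> real \<Rightarrow> particle list \<Rightarrow> bool" where
  "allowed_capture a b w \<longleftrightarrow>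
     (\<exists>m. (\<forall>i. m i > 0) \<and> m P1 / m P2 = a \<and> m P3 / m P2 = b \<and> capture_process m w)"

definition repeat :: "particle list \<Rightarrow> nat \<Rightarrow> particle list" where
  "repeat w n = concat (replicate n w)"

end

theory Submission
  imports Defs "HOL-Analysis.Euclidean_Space"
begin

text \<open>
  In mass-weighted relative coordinates a state is a pair of vectors in \<open>\<complex>\<^sup>3\<close>, and the positions in which
  the two particles other than \<open>i\<close> coincide form a complex line, for \<open>i = 1, 2, 3\<close>.  Any two unit
  vectors on the lines of \<open>i\<close> and \<open>j\<close> enclose a real angle between \<open>\<theta>\<^sub>i\<^sub>j\<close> and \<open>\<pi> - \<theta>\<^sub>i\<^sub>j\<close>, where the
  \<open>\<theta>\<^sub>i\<^sub>j\<close> are acute with sum \<open>\<pi>\<close>.  Consider the real angle between position and velocity.  A collision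
  preserves it, and a free flight lowers it by the angle between the two positions.  Initially the
  velocity is on the line of 1, so after the first collision \<open>i\<close> the angle is at most \<open>\<pi> - \<theta>\<^sub>1\<^sub>i\<close>;
  finally the velocity is on the line of 3, so the angle is at least \<open>\<theta>\<^sub>l\<^sub>3\<close> for the last collision
  \<open>l\<close>.  Hence the walk from 1 through the collision sequence to 3, with edge lengths \<open>\<theta>\<^sub>i\<^sub>j\<close>, has total
  length at most \<open>\<pi>\<close>.  If all three kinds of collision occurred, it would be longer than that: either it
  uses all three kinds of edges and one of them again, or it uses two kinds at least twice each and
  one of these three times, and any two \<open>\<theta>\<^sub>i\<^sub>j\<close> sum to more than \<open>\<pi> / 2\<close>.
\<close>

section \<open>Angles in real inner product spaces\<close>

text \<open>A zero argument makes the quotient 0 and the angle \<open>pi / 2\<close>, so the cosine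
  formula covers that case as well.\<close>

definition vec_angle :: "'a::real_inner \<Rightarrow> 'a \<Rightarrow> real" where
  "vec_angle u v = arccos (inner u v / (norm u * norm v))"

lemma inner_normalized_bounds:
  fixes u v :: "'a::real_inner"
  shows "-1 \<le> inner u v / (norm u * norm v)" "inner u v / (norm u * norm v) \<le> 1"
proof -
  have "\<bar>inner u v / (norm u * norm v)\<bar> \<le> 1"
    using Cauchy_Schwarz_ineq2[of u v] by (auto simp: divide_le_eq abs_mult)
  then show "-1 \<le> inner u v / (norm u * norm v)" "inner u v / (norm u * norm v) \<le> 1"
    unfolding abs_le_iff by linarith+
qed

lemma cos_vec_angle: "cos (vec_angle u v) = inner u v / (norm u * norm v)"
  unfolding vec_angle_def using inner_normalized_bounds[of u v] by (intro cos_arccos)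

lemma vec_angle_nonneg: "0 \<le> vec_angle u v"
  and vec_angle_le_pi: "vec_angle u v \<le> pi"
  unfolding vec_angle_def using inner_normalized_bounds[of u v]
  by (auto intro: arccos_lbound arccos_ubound)

lemma sin_vec_angle:
  assumes "u \<noteq> 0" "v \<noteq> 0"
  shows "sin (vec_angle u v) =
    sqrt ((norm u)\<^sup>2 * (norm v)\<^sup>2 - (inner u v)\<^sup>2) / (norm u * norm v)"
proof -
  have "sin (vec_angle u v) = sqrt (1 - (inner u v / (norm u * norm v))\<^sup>2)"
    unfolding vec_angle_def using inner_normalized_bounds[of u v] by (intro sin_arccos)
  also have "1 - (inner u v / (norm u * norm v))\<^sup>2 =
      ((norm u)\<^sup>2 * (norm v)\<^sup>2 - (inner u v)\<^sup>2) / (norm u * norm v)\<^sup>2"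
    using assms by (simp add: field_simps)
  finally show ?thesis
    by (simp add: real_sqrt_divide real_sqrt_abs abs_mult)
qed

text \<open>For \<open>t > 0\<close> the vector \<open>w\<close> lies in the planar sector between
  \<open>u\<close> and \<open>v\<close>, hence splits their angle. Analytically, both sides have the
  same cosine and lie in \<open>[0, pi]\<close>, where cosine is injective.\<close>

lemma vec_angle_free_flight:
  fixes u v :: "'a::real_inner" and t :: real
  defines "w \<equiv> u + t *\<^sub>R v"
  assumes "t > 0" "u \<noteq> 0" "v \<noteq> 0" "w \<noteq> 0"
  shows "vec_angle u v = vec_angle u w + vec_angle w v"
proof -
  \<comment> \<open>The Gram determinant of \<open>u\<close> and \<open>v\<close>; the pairs
    \<open>u, w\<close> and \<open>w, v\<close> have Gram determinants \<open>t\<^sup>2 * J\<close>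
    and \<open>J\<close>, which give the sines.\<close>
  define J where "J = (norm u)\<^sup>2 * (norm v)\<^sup>2 - (inner u v)\<^sup>2"
  have J: "J \<ge> 0"
    using Cauchy_Schwarz_ineq[of u v] by (simp add: J_def power2_norm_eq_inner)
  have pos: "norm u > 0" "norm v > 0" "norm w > 0"
    using assms by auto
  have uw: "inner u w = (norm u)\<^sup>2 + t * inner u v"
    and wv: "inner w v = inner u v + t * (norm v)\<^sup>2"
    and ww: "(norm w)\<^sup>2 = (norm u)\<^sup>2 + 2 * t * inner u v + t\<^sup>2 * (norm v)\<^sup>2"
    unfolding w_def power2_norm_eq_inner
    by (simp_all add: inner_add_left inner_add_right inner_commute power2_eq_square algebra_simps)
  have J1: "(norm u)\<^sup>2 * (norm w)\<^sup>2 - (inner u w)\<^sup>2 = t\<^sup>2 * J"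
    unfolding uw ww J_def by (simp add: power2_eq_square algebra_simps)
  have J2: "(norm w)\<^sup>2 * (norm v)\<^sup>2 - (inner w v)\<^sup>2 = J"
    unfolding wv ww J_def by (simp add: power2_eq_square algebra_simps)
  have "sin (vec_angle u w) * sin (vec_angle w v) =
      (t * sqrt J / (norm u * norm w)) * (sqrt J / (norm w * norm v))"
    using \<open>t > 0\<close> \<open>u \<noteq> 0\<close> \<open>v \<noteq> 0\<close> \<open>w \<noteq> 0\<close>
    by (simp add: sin_vec_angle J1 J2 real_sqrt_mult)
  also have "\<dots> = t * J / (norm u * norm v * (norm w)\<^sup>2)"
    using J by (simp add: power2_eq_square field_simps flip: real_sqrt_mult)
  finally have ss: "sin (vec_angle u w) * sin (vec_angle w v) =
      t * J / (norm u * norm v * (norm w)\<^sup>2)" .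
  have "cos (vec_angle u w + vec_angle w v) =
      (inner u w * inner w v - t * J) / (norm u * norm v * (norm w)\<^sup>2)"
    unfolding cos_add ss unfolding cos_vec_angle
    by (simp add: power2_eq_square diff_divide_distrib mult_ac)
  also have "inner u w * inner w v - t * J = inner u v * (norm w)\<^sup>2"
    unfolding uw wv ww J_def by (simp add: power2_eq_square algebra_simps)
  also have "\<dots> / (norm u * norm v * (norm w)\<^sup>2) = cos (vec_angle u v)"
    using pos by (simp add: cos_vec_angle)
  finally have cos_eq: "cos (vec_angle u w + vec_angle w v) = cos (vec_angle u v)" .
  \<comment> \<open>The angle sum is at most \<open>pi\<close> once the two cosines have nonnegative
    sum; this factorization reduces that to Cauchy-Schwarz.\<close>
  have "inner u w * norm v + inner w v * norm u
      = (norm u + t * norm v) * (norm u * norm v + inner u v)"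
    unfolding uw wv by (simp add: power2_eq_square algebra_simps)
  also have "\<dots> \<ge> 0"
    using Cauchy_Schwarz_ineq2[of u v] pos \<open>t > 0\<close> by (intro mult_nonneg_nonneg) auto
  finally have "0 \<le> (inner u w * norm v + inner w v * norm u) / (norm u * norm v * norm w)"
    using pos by simp
  also have "\<dots> = cos (vec_angle u w) + cos (vec_angle w v)"
    using pos by (simp add: cos_vec_angle field_simps)
  finally have "cos (pi - vec_angle w v) \<le> cos (vec_angle u w)"
    by (simp add: cos_diff)
  then have "vec_angle u w \<le> pi - vec_angle w v"
    using vec_angle_nonneg vec_angle_le_pi
    by (subst (asm) cos_mono_le_eq) auto
  then show ?thesis
    using cos_eq vec_angle_nonneg vec_angle_le_pi
    by (metis add_nonneg_nonneg cos_inj_pi le_diff_eq)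
qed

lemma vec_angle_bounds:
  assumes "u \<noteq> 0" "v \<noteq> 0" "0 \<le> c" "c \<le> 1" "\<bar>inner u v\<bar> \<le> c * (norm u * norm v)"
  shows "arccos c \<le> vec_angle u v" "vec_angle u v \<le> pi - arccos c"
proof -
  have "norm u * norm v > 0" using assms by simp
  then have b: "\<bar>inner u v / (norm u * norm v)\<bar> \<le> c"
    using assms(5) by (simp add: abs_mult divide_le_eq)
  then have b: "inner u v / (norm u * norm v) \<le> c" "- c \<le> inner u v / (norm u * norm v)"
    unfolding abs_le_iff by linarith+
  note bounds = inner_normalized_bounds[of u v]
  show "arccos c \<le> vec_angle u v"
    unfolding vec_angle_def using assms(4) b(1) bounds by (intro arccos_le_arccos)
  have "vec_angle u v \<le> arccos (- c)"
    unfolding vec_angle_def using assms(4) b(2) bounds by (intro arccos_le_arccos) auto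
  then show "vec_angle u v \<le> pi - arccos c"
    using assms by (simp add: arccos_minus)
qed

section \<open>Mass-weighted relative coordinates\<close>

text \<open>With these weights the squared norm of velocities is a constant multiple of the kinetic
  energy in the centre-of-mass frame.\<close>

definition rel_coords ::
  "(particle \<Rightarrow> real) \<Rightarrow> (particle \<Rightarrow> complex) \<Rightarrow> complex \<times> complex \<times> complex" where
  "rel_coords m q =
     (sqrt (m P1 * m P2) *\<^sub>R (q P1 - q P2),
      sqrt (m P2 * m P3) *\<^sub>R (q P2 - q P3),
      sqrt (m P3 * m P1) *\<^sub>R (q P3 - q P1))"

definition coincide :: "particle \<Rightarrow> (particle \<Rightarrow> complex) \<Rightarrow> bool" where
  "coincide i q \<longleftrightarrow> (\<forall>j k. j \<noteq> i \<and> k \<noteq> i \<longrightarrow> q j = q k)"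

text \<open>
  \<open>coincide i\<close> describes a complex line in the space of relative coordinates;
  \<open>line_cos m i j\<close> is the cosine of the angle between the lines of \<open>i\<close> and \<open>j\<close>.
\<close>

definition line_cos :: "(particle \<Rightarrow> real) \<Rightarrow> particle \<Rightarrow> particle \<Rightarrow> real" where
  "line_cos m i j =
     sqrt (m i * m j / ((m P1 + m P2 + m P3 - m i) * (m P1 + m P2 + m P3 - m j)))"

text \<open>The diagonal is set separately because \<open>line_cos m i i\<close> is
  \<open>m i\<close> over the mass of the other two particles, not 1.\<close>

definition line_angle :: "(particle \<Rightarrow> real) \<Rightarrow> particle \<Rightarrow> particle \<Rightarrow> real" where
  "line_angle m i j = (if i = j then 0 else arccos (line_cos m i j))"

lemma coincide_simps:
  "coincide P1 q \<longleftrightarrow> q P2 = q P3"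
  "coincide P2 q \<longleftrightarrow> q P1 = q P3"
  "coincide P3 q \<longleftrightarrow> q P1 = q P2"
  unfolding coincide_def by (metis (full_types) particle.exhaust particle.distinct)+

lemma coincide_third:
  assumes "distinct [i, j, k]"
  shows "coincide i q \<longleftrightarrow> q j = q k"
  using assms by (cases i; cases j; cases k) (auto simp: coincide_simps)

lemma obtain_others:
  obtains j k where "distinct [i, j, k :: particle]"
  by (cases i) (use that[of P2 P3] that[of P3 P1] that[of P1 P2] in simp_all)

lemma obtain_third:
  assumes "i \<noteq> j"
  obtains k where "distinct [i, j, k :: particle]"
  using assms
  by (cases i; cases j) (use that[of P1] that[of P2] that[of P3] in simp_all)

lemma rel_coords_flight:
  "rel_coords m (\<lambda>j. q j + of_real t * v j) = rel_coords m q + t *\<^sub>R rel_coords m v"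
  unfolding rel_coords_def by (simp add: scaleR_conv_of_real algebra_simps)

lemma total_mass:
  assumes "distinct [i, j, k]"
  shows "m P1 + m P2 + m P3 = (m i + m j + m k :: real)"
  using assms by (cases i; cases j; cases k) auto

text \<open>Replaces the cyclic definition by a form valid for every labelling, so that later
  arguments treat all pairs at once.\<close>

lemma inner_rel_coords:
  assumes "\<forall>i. m i > 0" "distinct [i, j, k]"
  shows "inner (rel_coords m q) (rel_coords m q') =
    m i * m j * inner (q i - q j) (q' i - q' j) +
    m i * m k * inner (q i - q k) (q' i - q' k) +
    m j * m k * inner (q j - q k) (q' j - q' k)"
proof -
  have s: "sqrt (m a * m b) * (sqrt (m a * m b) * x) = m a * m b * x" for a b x
  proof -
    have "0 \<le> m a * m b" using assms(1) by (simp add: less_imp_le)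
    then show ?thesis by (simp only: mult.assoc[symmetric] real_sqrt_mult_self abs_of_nonneg)
  qed
  have "inner (rel_coords m q) (rel_coords m q') =
    m P1 * m P2 * inner (q P1 - q P2) (q' P1 - q' P2) +
    m P2 * m P3 * inner (q P2 - q P3) (q' P2 - q' P3) +
    m P3 * m P1 * inner (q P3 - q P1) (q' P3 - q' P1)"
    by (simp only: rel_coords_def inner_prod_def fst_conv snd_conv inner_scaleR_left
        inner_scaleR_right s add.assoc)
  then show ?thesis
    using assms(2)
    by (cases i; cases j; cases k) (simp_all add: inner_diff_left inner_diff_right algebra_simps)
qed

lemma line_cos_third:
  assumes "distinct [i, j, k]"
  shows "line_cos m i j = sqrt (m i * m j / ((m j + m k) * (m i + m k)))"
proof -
  have "m P1 + m P2 + m P3 - m i = m j + m k" "m P1 + m P2 + m P3 - m j = m i + m k"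
    using total_mass[OF assms, of m] by simp_all
  then show ?thesis by (simp add: line_cos_def)
qed

lemma line_cos_bounds:
  assumes m: "\<forall>i. m i > 0" and "i \<noteq> j"
  shows "0 < line_cos m i j" "line_cos m i j < 1"
proof -
  obtain k where d: "distinct [i, j, k]" using obtain_third[OF assms(2)] .
  have pos: "m i > 0" "m j > 0" "m k > 0" using m by auto
  have "m i * m j < (m j + m k) * (m i + m k)"
    using pos by (simp add: algebra_simps add_pos_pos)
  then show "0 < line_cos m i j" "line_cos m i j < 1"
    using pos by (simp_all add: line_cos_third[OF d] add_pos_pos)
qed

lemma line_angle_bounds:
  assumes m: "\<forall>i. m i > 0" and "i \<noteq> j"
  shows "0 < line_angle m i j" "line_angle m i j < pi / 2"
  using line_cos_bounds[OF assms] assms(2) arccos_lt_bounded[of "line_cos m i j"]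
    arccos_less_mono[of "line_cos m i j" 0]
  by (auto simp: line_angle_def)

lemma line_angle_commute: "line_angle m i j = line_angle m j i"
  by (simp add: line_angle_def line_cos_def mult.commute)

text \<open>For collinear particles the three lines lie in one real plane and cut it into six
  sectors, opposite ones being equal. The proof computes that the cosine of two angles' sum is minus
  the cosine of the third; acuteness then allows inverting the cosine.\<close>

lemma line_angle_triangle_sum:
  assumes m: "\<forall>i. m i > 0" and d: "distinct [i, j, k]"
  shows "line_angle m i j + line_angle m j k + line_angle m i k = pi"
proof -
  have pos: "m i > 0" "m j > 0" "m k > 0" using m by auto
  have ne: "i \<noteq> j" "j \<noteq> k" "i \<noteq> k" using d by auto
  \<comment> \<open>The common denominator of the product of cosines, the product of sines and the
    third cosine.\<close>
  define D where "D = (m i + m k) * sqrt ((m j + m k) * (m i + m j))"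
  have D: "D > 0" using pos by (simp add: D_def add_pos_pos)
  define g where "g = sqrt (m i * m k)"
  have d': "distinct [j, k, i]" "distinct [i, k, j]" using d by auto
  have cc: "line_cos m i j = sqrt (m i * m j) / sqrt ((m j + m k) * (m i + m k))"
    "line_cos m j k = sqrt (m j * m k) / sqrt ((m i + m k) * (m i + m j))"
    "line_cos m i k = g / sqrt ((m j + m k) * (m i + m j))"
    using line_cos_third[OF d, of m] line_cos_third[OF d'(1), of m] line_cos_third[OF d'(2), of m]
    by (simp_all add: real_sqrt_divide g_def add_ac mult_ac)
  have prod: "sqrt (m i * m j) * sqrt (m j * m k) = m j * g"
    "sqrt ((m j + m k) * (m i + m k)) * sqrt ((m i + m k) * (m i + m j)) = D"
    using pos by (simp_all add: g_def D_def real_sqrt_mult)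
  have c3: "line_cos m i k = (m i + m k) * g / D"
    using pos by (simp add: cc D_def)
  have sq: "(sqrt x / sqrt y)\<^sup>2 = x / y" if "x > 0" "y > 0" for x y :: real
    using that by (simp add: power_divide)
  have frac: "1 - a / d = e / d" if "d > 0" "d = a + e" for a d e :: real
  proof -
    have "e = d - a" using that(2) by simp
    then show ?thesis using that(1) by (simp add: diff_divide_distrib)
  qed
  \<comment> \<open>Uses \<open>(m j + m k) * (m i + m k) = m i * m j + m k * (m i + m j + m
    k)\<close>.\<close>
  have s1: "sqrt (1 - (line_cos m i j)\<^sup>2) =
      sqrt (m k * (m i + m j + m k)) / sqrt ((m j + m k) * (m i + m k))"
  proof -
    have "(line_cos m i j)\<^sup>2 = m i * m j / ((m j + m k) * (m i + m k))"
      unfolding cc(1) by (intro sq mult_pos_pos add_pos_pos pos)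
    moreover have "1 - m i * m j / ((m j + m k) * (m i + m k)) =
        (m k * (m i + m j + m k)) / ((m j + m k) * (m i + m k))"
      by (rule frac, intro mult_pos_pos add_pos_pos pos, simp add: algebra_simps)
    ultimately have "1 - (line_cos m i j)\<^sup>2 = (m k * (m i + m j + m k)) / ((m j + m k) * (m i + m k))"
      by (simp only:)
    then show ?thesis by (simp only: real_sqrt_divide)
  qed
  have s2: "sqrt (1 - (line_cos m j k)\<^sup>2) =
      sqrt (m i * (m i + m j + m k)) / sqrt ((m i + m k) * (m i + m j))"
  proof -
    have "(line_cos m j k)\<^sup>2 = m j * m k / ((m i + m k) * (m i + m j))"
      unfolding cc(2) by (intro sq mult_pos_pos add_pos_pos pos)
    moreover have "1 - m j * m k / ((m i + m k) * (m i + m j)) =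
        (m i * (m i + m j + m k)) / ((m i + m k) * (m i + m j))"
      by (rule frac, intro mult_pos_pos add_pos_pos pos, simp add: algebra_simps)
    ultimately have "1 - (line_cos m j k)\<^sup>2 = (m i * (m i + m j + m k)) / ((m i + m k) * (m i + m j))"
      by (simp only:)
    then show ?thesis by (simp only: real_sqrt_divide)
  qed
  have sprod: "sqrt (m k * (m i + m j + m k)) * sqrt (m i * (m i + m j + m k)) =
      (m i + m j + m k) * g"
    using pos by (simp add: g_def real_sqrt_mult)
  note b = line_cos_bounds[OF m ne(1)] line_cos_bounds[OF m ne(2)] line_cos_bounds[OF m ne(3)]
  have "cos (line_angle m i j + line_angle m j k) =
      line_cos m i j * line_cos m j k -
      sqrt (1 - (line_cos m i j)\<^sup>2) * sqrt (1 - (line_cos m j k)\<^sup>2)"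
    using b ne by (simp add: line_angle_def cos_add sin_arccos)
  also have "line_cos m i j * line_cos m j k = m j * g / D"
    unfolding cc(1,2) times_divide_times_eq prod ..
  also have "sqrt (1 - (line_cos m i j)\<^sup>2) * sqrt (1 - (line_cos m j k)\<^sup>2) =
      (m i + m j + m k) * g / D"
    unfolding s1 s2 times_divide_times_eq prod sprod ..
  also have "m j * g / D - (m i + m j + m k) * g / D = - line_cos m i k"
  proof -
    have "m j * g - (m i + m j + m k) * g = - ((m i + m k) * g)" by (simp add: algebra_simps)
    then show ?thesis by (simp only: c3 minus_divide_left flip: diff_divide_distrib)
  qed
  also have "\<dots> = cos (pi - line_angle m i k)"
    using b ne by (simp add: line_angle_def cos_diff)
  finally have cos_eq: "cos (line_angle m i j + line_angle m j k) = cos (pi - line_angle m i k)" .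
  have "line_angle m i j + line_angle m j k = pi - line_angle m i k"
  proof (rule cos_inj_pi[OF _ _ _ _ cos_eq])
    show "0 \<le> line_angle m i j + line_angle m j k" "line_angle m i j + line_angle m j k \<le> pi"
      using line_angle_bounds[OF m ne(1)] line_angle_bounds[OF m ne(2)] by linarith+
    show "0 \<le> pi - line_angle m i k" "pi - line_angle m i k \<le> pi"
      using line_angle_bounds[OF m ne(3)] by linarith+
  qed
  then show ?thesis by linarith
qed

text \<open>Only the \<open>i, j\<close> term of the inner product survives, and Cauchy-Schwarz
  bounds it by \<open>line_cos m i j\<close> times the norms. The bound is two-sided because the
  lines are complex and the phases are free.\<close>

lemma coincide_angle_bounds:
  assumes m: "\<forall>i. m i > 0" and "i \<noteq> j" and "coincide i q" "coincide j q'"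
    and nz: "rel_coords m q \<noteq> 0" "rel_coords m q' \<noteq> 0"
  shows "line_angle m i j \<le> vec_angle (rel_coords m q) (rel_coords m q')"
    and "vec_angle (rel_coords m q) (rel_coords m q') \<le> pi - line_angle m i j"
proof -
  obtain k where d: "distinct [i, j, k]" using obtain_third[OF assms(2)] .
  have pos: "m i > 0" "m j > 0" "m k > 0" using m by auto
  have q: "q j = q k" using assms(3) coincide_third[OF d] by simp
  have q': "q' i = q' k" using assms(4) coincide_third[of j i k] d by auto
  have nq: "norm (rel_coords m q) = sqrt (m i * (m j + m k)) * norm (q i - q j)"
    unfolding norm_eq_sqrt_inner inner_rel_coords[OF m d]
    by (simp add: q algebra_simps flip: real_sqrt_mult)
  have nq': "norm (rel_coords m q') = sqrt (m j * (m i + m k)) * norm (q' i - q' j)"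
    unfolding norm_eq_sqrt_inner inner_rel_coords[OF m d]
    by (simp add: q' algebra_simps inner_diff_left inner_diff_right inner_commute
        flip: real_sqrt_mult)
  have c: "line_cos m i j * (sqrt (m i * (m j + m k)) * sqrt (m j * (m i + m k))) = m i * m j"
  proof -
    have "line_cos m i j * (sqrt (m i * (m j + m k)) * sqrt (m j * (m i + m k))) =
        sqrt ((m i * m j / ((m j + m k) * (m i + m k))) *
              ((m i * (m j + m k)) * (m j * (m i + m k))))"
      unfolding line_cos_third[OF d] real_sqrt_mult ..
    also have "(m i * m j / ((m j + m k) * (m i + m k))) *
        ((m i * (m j + m k)) * (m j * (m i + m k))) = (m i * m j)\<^sup>2"
    proof -
      have "m j + m k \<noteq> 0" "m i + m k \<noteq> 0" using pos by linarith+
      then show ?thesis by (simp add: power2_eq_square)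
    qed
    finally show ?thesis using pos by simp
  qed
  have "\<bar>inner (rel_coords m q) (rel_coords m q')\<bar> =
      m i * m j * \<bar>inner (q i - q j) (q' i - q' j)\<bar>"
    using pos by (simp add: inner_rel_coords[OF m d] q q' abs_mult)
  also have "\<dots> \<le> m i * m j * (norm (q i - q j) * norm (q' i - q' j))"
    using pos by (intro mult_left_mono Cauchy_Schwarz_ineq2) auto
  also have "\<dots> = line_cos m i j * (norm (rel_coords m q) * norm (rel_coords m q'))"
    unfolding nq nq' c[symmetric] by (simp add: mult_ac)
  finally have le: "\<bar>inner (rel_coords m q) (rel_coords m q')\<bar> \<le>
      line_cos m i j * (norm (rel_coords m q) * norm (rel_coords m q'))" .
  show "line_angle m i j \<le> vec_angle (rel_coords m q) (rel_coords m q')"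
    and "vec_angle (rel_coords m q) (rel_coords m q') \<le> pi - line_angle m i j"
    using vec_angle_bounds[OF nz _ _ le] line_cos_bounds[OF m assms(2)] assms(2)
    by (auto simp: line_angle_def)
qed

section \<open>Collisions and free flights\<close>

text \<open>Splits a weighted sum of squares into a momentum part and a relative part, the two
  quantities a collision controls.\<close>

lemma weighted_norm_squares:
  fixes a b :: "'a::real_inner"
  assumes "p > 0" "r > 0"
  shows "p * inner a a + r * inner b b =
    (inner (p *\<^sub>R a + r *\<^sub>R b) (p *\<^sub>R a + r *\<^sub>R b) + p * r * inner (a - b) (a - b)) / (p + r)"
proof -
  have "(p * inner a a + r * inner b b) * (p + r) =
    inner (p *\<^sub>R a + r *\<^sub>R b) (p *\<^sub>R a + r *\<^sub>R b) + p * r * inner (a - b) (a - b)"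
    by (simp add: inner_add_left inner_add_right inner_diff_left inner_diff_right
        inner_commute algebra_simps)
  then show ?thesis using assms by (simp add: field_simps)
qed

lemma collision_coincide:
  assumes "collision m i x q v v'" "cmod x = 1"
  shows "coincide i q" "\<not> coincide i v" "\<not> coincide i v'"
proof -
  obtain j k where d: "distinct [i, j, k]" using obtain_others .
  then have "j \<noteq> i \<and> k \<noteq> i \<and> j \<noteq> k" by auto
  then have "q j = q k" "v j \<noteq> v k" "v' j - v' k = x * (v j - v k)"
    using assms(1) unfolding collision_def by blast+
  moreover have "x \<noteq> 0" using assms(2) by auto
  ultimately show "coincide i q" "\<not> coincide i v" "\<not> coincide i v'"
    by (auto simp: coincide_third[OF d])
qed

text \<open>Since the colliding particles share a position, the inner product with the velocity sees
  only the pair's momentum relative to the spectator, which is conserved; the norm is fixed by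
  energy conservation.\<close>

lemma collision_vec_angle:
  assumes m: "\<forall>i. m i > 0" and col: "collision m i x q v v'" and x: "cmod x = 1"
  shows "vec_angle (rel_coords m q) (rel_coords m v') =
         vec_angle (rel_coords m q) (rel_coords m v)"
proof -
  obtain j k where d: "distinct [i, j, k]" using obtain_others .
  have pos: "m i > 0" "m j > 0" "m k > 0" using m by auto
  have "j \<noteq> i \<and> k \<noteq> i \<and> j \<noteq> k" using d by auto
  then have q: "q j = q k"
    and mom: "of_real (m j) * v' j + of_real (m k) * v' k =
              of_real (m j) * v j + of_real (m k) * v k"
    and rel: "v' j - v' k = x * (v j - v k)"
    and spec: "v' i = v i"
    using col unfolding collision_def by blast+
  have inner_sum: "inner (rel_coords m q) (rel_coords m u) =
      m i * inner (q i - q j) (m j *\<^sub>R (u i - u j) + m k *\<^sub>R (u i - u k))" for u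
    unfolding inner_rel_coords[OF m d]
    by (simp add: q inner_add_right algebra_simps)
  have mom': "m j *\<^sub>R (v' i - v' j) + m k *\<^sub>R (v' i - v' k) =
      m j *\<^sub>R (v i - v j) + m k *\<^sub>R (v i - v k)"
    using mom by (simp add: spec scaleR_conv_of_real algebra_simps)
  have norm_rel: "inner (v' j - v' k) (v' j - v' k) = inner (v j - v k) (v j - v k)"
    by (simp add: rel norm_mult x flip: power2_norm_eq_inner)
  have energy: "inner (rel_coords m u) (rel_coords m u) =
      m i * ((inner (m j *\<^sub>R (u i - u j) + m k *\<^sub>R (u i - u k))
                    (m j *\<^sub>R (u i - u j) + m k *\<^sub>R (u i - u k)) +
              m j * m k * inner (u j - u k) (u j - u k)) / (m j + m k)) +
      m j * m k * inner (u j - u k) (u j - u k)" for u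
  proof -
    have "inner (u i - u j - (u i - u k)) (u i - u j - (u i - u k)) =
        inner (u j - u k) (u j - u k)"
      by (simp add: inner_diff_left inner_diff_right)
    then show ?thesis
      unfolding inner_rel_coords[OF m d]
      using weighted_norm_squares[OF pos(2,3), of "u i - u j" "u i - u k"]
      by (simp only: mult.assoc distrib_left[symmetric])
  qed
  have "inner (rel_coords m q) (rel_coords m v') = inner (rel_coords m q) (rel_coords m v)"
    by (simp only: inner_sum mom')
  moreover have "norm (rel_coords m v') = norm (rel_coords m v)"
    unfolding norm_eq_sqrt_inner by (simp only: energy mom' norm_rel)
  ultimately show ?thesis by (simp add: vec_angle_def)
qed

section \<open>Angle budget along a motion\<close>

fun walk_length :: "(particle \<Rightarrow> real) \<Rightarrow> particle list \<Rightarrow> real" where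
  "walk_length m (i # j # w) = line_angle m i j + walk_length m (j # w)"
| "walk_length m _ = 0"

lemma coincide_rel_coords_nonzero:
  assumes "\<forall>i. m i > 0" "\<not> coincide i v"
  shows "rel_coords m v \<noteq> 0"
proof -
  have "m P1 > 0" "m P2 > 0" "m P3 > 0" using assms by auto
  then show ?thesis
    using assms(2)
    by (cases i) (auto simp: rel_coords_def coincide_simps zero_prod_def)
qed

text \<open>Here \<open>i\<close> is the latest collision and \<open>(q, v)\<close> the state just
  after it. In the induction each flight spends at least one edge length of the angle, and
  collisions spend nothing.\<close>

lemma motion_walk_length:
  assumes "motion m q v w q'' v''"
    and "\<forall>i. m i > 0" "v'' P1 = v'' P2"
    and "coincide i q" "rel_coords m q \<noteq> 0" "\<not> coincide i v"
  shows "distinct_adj (i # w @ [P3]) \<and>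
    walk_length m (i # w @ [P3]) \<le> vec_angle (rel_coords m q) (rel_coords m v)"
  using assms
proof (induction arbitrary: i rule: motion.induct)
  case (motion_Nil q v)
  have v3: "coincide P3 v" using motion_Nil by (simp add: coincide_simps)
  then have "i \<noteq> P3" using motion_Nil by auto
  then show ?case
    using coincide_angle_bounds(1)[OF motion_Nil(1) _ motion_Nil(3) v3]
      motion_Nil coincide_rel_coords_nonzero
    by auto
next
  case (motion_Cons t x q' q v j v' w q'' v'')
  note m = \<open>\<forall>i. m i > 0\<close>
  note col = collision_coincide[OF \<open>collision m j x q' v v'\<close> \<open>cmod x = 1\<close>]
  have q': "q' = (\<lambda>k. q k + of_real t * v k)" by fact
  \<comment> \<open>The pair separates at nonzero relative velocity for positive time, so it cannot
    collide twice in a row; a triple coincidence is excluded too.\<close>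
  have "\<not> coincide i q'"
  proof -
    obtain a b where d: "distinct [i, a, b]" using obtain_others .
    show ?thesis
      using motion_Cons.prems \<open>t > 0\<close> by (simp add: coincide_third[OF d] q')
  qed
  then have ij: "i \<noteq> j" using col by auto
  have nz: "rel_coords m q' \<noteq> 0" "rel_coords m v \<noteq> 0"
    using coincide_rel_coords_nonzero[OF m] \<open>\<not> coincide i q'\<close> motion_Cons.prems by auto
  have IH: "distinct_adj (j # w @ [P3])"
    "walk_length m (j # w @ [P3]) \<le> vec_angle (rel_coords m q') (rel_coords m v')"
    using motion_Cons.IH[OF m \<open>v'' P1 = v'' P2\<close> col(1) nz(1) col(3)] by auto
  have "vec_angle (rel_coords m q) (rel_coords m v) =
      vec_angle (rel_coords m q) (rel_coords m q') + vec_angle (rel_coords m q') (rel_coords m v)"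
    using vec_angle_free_flight[OF \<open>t > 0\<close> \<open>rel_coords m q \<noteq> 0\<close> nz(2)] nz(1)
    unfolding q' rel_coords_flight by simp
  moreover have "line_angle m i j \<le> vec_angle (rel_coords m q) (rel_coords m q')"
    using coincide_angle_bounds(1)[OF m ij \<open>coincide i q\<close> col(1)] nz motion_Cons.prems by auto
  moreover note collision_vec_angle[OF m \<open>collision m j x q' v v'\<close> \<open>cmod x = 1\<close>]
  ultimately show ?case using IH ij by simp
qed

lemma capture_walk_length:
  assumes m: "\<forall>i. m i > 0" and "capture_process m w" "w \<noteq> []"
  shows "distinct_adj (P1 # w @ [P3]) \<and> walk_length m (P1 # w @ [P3]) \<le> pi"
proof -
  obtain q v q'' v'' where v: "v P1 \<noteq> 0" "v P2 = 0" "v P3 = 0" "q P2 \<noteq> q P3"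
    and mo: "motion m q v w q'' v''" and fin: "v'' P1 = v'' P2"
    using assms(2) unfolding capture_process_def by blast
  obtain i u where w: "w = i # u" using assms(3) by (cases w) auto
  from mo[unfolded w] obtain t x q' v' where
    x: "cmod x = 1" and q': "q' = (\<lambda>j. q j + of_real t * v j)"
    and c: "collision m i x q' v v'" and mo': "motion m q' v' u q'' v''"
    by cases blast
  note col = collision_coincide[OF c x]
  have v1: "coincide P1 v" using v by (simp add: coincide_simps)
  then have i: "P1 \<noteq> i" using col by auto
  \<comment> \<open>Particles 2 and 3 are still at rest at distinct points, so the position vector
    is nonzero.\<close>
  have "\<not> coincide P1 q'" using v by (simp add: coincide_simps q')
  then have nz: "rel_coords m q' \<noteq> 0" "rel_coords m v \<noteq> 0"
    using coincide_rel_coords_nonzero[OF m] col by auto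
  have "vec_angle (rel_coords m q') (rel_coords m v) \<le> pi - line_angle m i P1"
    using coincide_angle_bounds(2)[OF m _ col(1) v1 nz] i by auto
  then show ?thesis
    using motion_walk_length[OF mo' m fin col(1) nz(1) col(3)] i
      collision_vec_angle[OF m c x] w
    by (simp add: line_angle_commute)
qed

section \<open>Short walks on three lines\<close>

text \<open>For distinct lines the right side is \<open>pi\<close> minus an acute angle, hence
  exceeds \<open>pi / 2\<close>.\<close>

lemma line_angle_triangle:
  assumes m: "\<forall>i. m i > 0"
  shows "line_angle m i k \<le> line_angle m i j + line_angle m j k"
proof (cases "distinct [i, j, k]")
  case True
  then show ?thesis
    using line_angle_triangle_sum[OF m True] line_angle_bounds[OF m, of i k] by auto
next
  case False
  then consider "i = j" | "j = k" | "i = k" by auto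
  then show ?thesis
  proof cases
    case 3
    then show ?thesis
      using line_angle_bounds(1)[OF m, of i j] line_angle_bounds(1)[OF m, of j i]
      by (cases "i = j") (auto simp: line_angle_def)
  qed (auto simp: line_angle_def)
qed

text \<open>Dropping intermediate letters never lengthens a walk, so lower bounds may be checked on
  a subsequence.\<close>

lemma walk_length_shortcut:
  assumes m: "\<forall>i. m i > 0"
  shows "line_angle m i j + walk_length m (j # w) \<le> walk_length m (i # u @ j # w)"
proof (induction u arbitrary: i)
  case (Cons k u)
  show ?case using line_angle_triangle[OF m, of i j k] Cons[of k] by simp
qed simp

lemma walk_through_all_lines:
  assumes m: "\<forall>i. m i > 0"
    and adj: "distinct_adj (P1 # w @ [P3])"
    and all: "P1 \<in> set w" "P2 \<in> set w" "P3 \<in> set w"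
  shows "walk_length m (P1 # w @ [P3]) > pi"
proof -
  define A B C where "A = line_angle m P1 P2" "B = line_angle m P2 P3" "C = line_angle m P1 P3"
  have sum: "A + B + C = pi"
    using line_angle_triangle_sum[OF m, of P1 P2 P3] by (simp add: A_B_C_def)
  have bounds: "0 < A" "A < pi / 2" "0 < B" "B < pi / 2" "0 < C" "C < pi / 2"
    using line_angle_bounds[OF m] by (simp_all add: A_B_C_def)
  have eqs: "line_angle m P1 P2 = A" "line_angle m P2 P3 = B" "line_angle m P1 P3 = C"
    "line_angle m P2 P1 = A" "line_angle m P3 P2 = B" "line_angle m P3 P1 = C"
    by (auto simp: A_B_C_def line_angle_commute)
  note short = walk_length_shortcut[OF m]
  obtain i u where w: "w = i # u" using all by (cases w) auto
  have "i = P2 \<or> i = P3" using adj w by (cases i) auto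
  then show ?thesis
  proof
    \<comment> \<open>The walk reduces to 1, 3, 2, 1, 3 or to 1, 3, 1, 2, 3; both have length
      \<open>pi + C\<close>.\<close>
    assume i: "i = P3"
    have mem: "P1 \<in> set u" "P2 \<in> set u" using all i w by auto
    obtain u1 u2 where u: "u = u1 @ P1 # u2" using split_list[OF mem(1)] by blast
    then consider "P2 \<in> set u1" | "P2 \<in> set u2" using mem by auto
    then show ?thesis
    proof cases
      case 1
      then obtain u3 u4 where u1: "u1 = u3 @ P2 # u4" using split_list by metis
      show ?thesis
        using short[of P3 P2 "u4 @ P1 # u2 @ [P3]" u3] short[of P2 P1 "u2 @ [P3]" u4]
          short[of P1 P3 "[]" u2] sum bounds
        by (simp add: w i u u1 eqs)
    next
      case 2
      then obtain u3 u4 where u2: "u2 = u3 @ P2 # u4" using split_list by metis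
      show ?thesis
        using short[of P3 P1 "u2 @ [P3]" u1] short[of P1 P2 "u4 @ [P3]" u3]
          short[of P2 P3 "[]" u4] sum bounds
        by (simp add: w i u u2 eqs)
    qed
  next
    assume i: "i = P2"
    have mem: "P1 \<in> set u" "P3 \<in> set u" using all i w by auto
    obtain u1 u2 where u: "u = u1 @ P3 # u2" using split_list[OF mem(2)] by blast
    then consider "P1 \<in> set u2" | "P1 \<in> set u1" using mem by auto
    then show ?thesis
    proof cases
      \<comment> \<open>The reduced walk 1, 2, 3, 1, 3 again has length
        \<open>pi + C\<close>.\<close>
      case 1
      then obtain u3 u4 where u2: "u2 = u3 @ P1 # u4" using split_list by metis
      show ?thesis
        using short[of P2 P3 "u2 @ [P3]" u1] short[of P3 P1 "u4 @ [P3]" u3]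
          short[of P1 P3 "[]" u4] sum bounds
        by (simp add: w i u u2 eqs)
    next
      case 2
      then obtain u3 u4 where u1: "u1 = u3 @ P1 # u4" using split_list by metis
      \<comment> \<open>The appended \<open>P3\<close> forbids ending in \<open>P3\<close>, so there
        is a further excursion from 3 to \<open>k\<close> and back. The length is at least
        \<open>2 * A + C + 2 * B = pi + A + B\<close> for \<open>k = P2\<close>, and
        \<open>2 * A + 3 * C\<close> for \<open>k = P1\<close>, where
        \<open>A + C > pi / 2\<close>.\<close>
      have "u2 \<noteq> []" using adj by (auto simp: w u distinct_adj_append_iff distinct_adj_Cons)
      then obtain k u5 where u2: "u2 = k # u5" by (cases u2) auto
      have k: "k = P1 \<or> k = P2"
        using adj by (cases k) (auto simp: w u u2 distinct_adj_append_iff distinct_adj_Cons)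
      show ?thesis
        using short[of P2 P1 "u4 @ P3 # u2 @ [P3]" u3] short[of P1 P3 "u2 @ [P3]" u4]
          short[of k P3 "[]" u5] sum bounds k
        by (auto simp: w i u u1 u2 eqs)
    qed
  qed
qed

section \<open>Alternating words\<close>

lemma alternating_word:
  assumes "distinct_adj w" "set w \<subseteq> {a, b}" "w \<noteq> []" "hd w = a"
  shows "\<exists>n. w = repeat [a, b] n \<or> w = repeat [a, b] n @ [a]"
  using assms
proof (induction w rule: induct_list012)
  case (3 x y w)
  then have xy: "x = a" "y = b" by auto
  show ?case
  proof (cases w)
    case Nil
    then show ?thesis using xy by (intro exI[of _ 1]) (simp add: repeat_def)
  next
    case (Cons z u)
    then have "z = a" using 3 xy by auto
    then obtain n where "w = repeat [a, b] n \<or> w = repeat [a, b] n @ [a]"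
      using 3 Cons xy by (auto simp: distinct_adj_Cons)
    then show ?thesis using xy by (intro exI[of _ "Suc n"]) (auto simp: repeat_def)
  qed
qed (auto intro: exI[of _ 0] simp: repeat_def)

lemma repeat_shift: "repeat [a, b] n @ [a] = [a] @ repeat [b, a] n"
  by (induction n) (auto simp: repeat_def)

lemma last_repeat: "n \<ge> 1 \<Longrightarrow> last (repeat [a, b] n) = b"
  by (cases n) (simp_all add: repeat_def flip: replicate_append_same)

theorem mainTheorem6:
  fixes a b :: real and w :: "particle list"
  assumes "a > 0" and "b > 0"
    and "length w \<ge> 2"
    and "allowed_capture a b w"
  shows "\<exists>n::nat. n \<ge> 1 \<and>
           (w = repeat [P3, P2] n \<or>
            w = [P2] @ repeat [P3, P2] n \<or>
            w = repeat [P2, P1] n \<or>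
            w = repeat [P2, P1] n @ [P2] \<or>
            w = repeat [P3, P1] n)"
proof -
  obtain m where m: "\<forall>i. m i > 0" and cap: "capture_process m w"
    using assms(4) unfolding allowed_capture_def by blast
  have ne: "w \<noteq> []" using assms(3) by auto
  have adj: "distinct_adj (P1 # w @ [P3])" and len: "walk_length m (P1 # w @ [P3]) \<le> pi"
    using capture_walk_length[OF m cap ne] by auto
  have missing: "\<not> (P1 \<in> set w \<and> P2 \<in> set w \<and> P3 \<in> set w)"
    using walk_through_all_lines[OF m adj] len by auto
  \<comment> \<open>Adjacency to the added endpoints restricts the first and last letters.\<close>
  have adj': "distinct_adj w" and hd: "hd w \<noteq> P1" and last: "last w \<noteq> P3"
    using adj ne by (auto simp: distinct_adj_append_iff distinct_adj_Cons)
  have alt: "\<exists>n\<ge>1. w = repeat [x, y] n \<or> w = repeat [x, y] n @ [x]"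
    if sub: "set w \<subseteq> {x, y}" and x: "hd w = x" for x y
  proof -
    obtain n where n: "w = repeat [x, y] n \<or> w = repeat [x, y] n @ [x]"
      using alternating_word[OF adj' sub ne x] by blast
    \<comment> \<open>For \<open>n = 0\<close> the word would have at most one letter.\<close>
    have "n \<noteq> 0" using n assms(3) by (intro notI) (auto simp: repeat_def)
    then show ?thesis using n by (intro exI[of _ n]) auto
  qed
  have two: "set w \<subseteq> {x, y}" if "z \<notin> set w" "distinct [x, y, z]" for x y z
  proof
    fix k assume "k \<in> set w"
    then have "k \<noteq> z" using that(1) by auto
    with that(2) show "k \<in> {x, y}" by (cases k; cases x; cases y; cases z) simp_all
  qed
  consider "hd w = P2" "P1 \<notin> set w" | "hd w = P2" "P3 \<notin> set w"
    | "hd w = P3" "P1 \<notin> set w" | "hd w = P3" "P2 \<notin> set w"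
    using missing hd list.set_sel(1)[OF ne] by (cases "hd w") auto
  then show ?thesis
  proof cases
    case 1
    then have "set w \<subseteq> {P2, P3}" by (intro two[of P1]) auto
    then obtain n where n: "n \<ge> 1" and "w = repeat [P2, P3] n \<or> w = repeat [P2, P3] n @ [P2]"
      using alt 1 by blast
    \<comment> \<open>A word ending in \<open>P3\<close> is ruled out, which leaves the odd length;
      in the two cases starting with \<open>P3\<close> the same fact leaves the even length.\<close>
    then have "w = [P2] @ repeat [P3, P2] n"
      using last last_repeat[of n P2 P3] repeat_shift[of P2 P3 n] by auto
    then show ?thesis using n by blast
  next
    case 2
    then have "set w \<subseteq> {P2, P1}" by (intro two[of P3]) auto
    then show ?thesis using alt 2 by blast
  next
    case 3
    then have "set w \<subseteq> {P3, P2}" by (intro two[of P1]) auto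
    then obtain n where "n \<ge> 1" "w = repeat [P3, P2] n \<or> w = repeat [P3, P2] n @ [P3]"
      using alt 3 by blast
    then show ?thesis using last by auto
  next
    case 4
    then have "set w \<subseteq> {P3, P1}" by (intro two[of P2]) auto
    then obtain n where "n \<ge> 1" "w = repeat [P3, P1] n \<or> w = repeat [P3, P1] n @ [P3]"
      using alt 4 by blast
    then show ?thesis using last by auto
  qed
qed

end
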